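(* Each of the games $W^2$ and $W^3$ has no redundant move: for every single move $m\in\{(i,0),(0,i),(i,i): i\ge 1\}$, removing $m$ from the rule-set of $W^2$ (respectively $W^3$) changes the set of $\mathcal{P}$-positions.
   Context: Positions are pairs $(x,y)\in\mathbb{N}^2$. The rule-set of Wythoff moves is $\{(i,0),(0,i),(i,i): i\ge1\}$; playing move $(u,v)$ from $(x,y)$ leads to $(x-u,y-v)$ provided both coordinates remain nonnegative; the options of a position are the positions reachable in one move. For $k\ge1$, in the game $W^k$ two players alternate moves; before each move, the player who has just moved may declare at most $k-1$ of the options of the current position forbidden, and the player about to move must then move to a non-forbidden option; the prohibition has no effect on later moves. Normal play: a player unable to move loses. A $\mathcal{P}$-position is a position from which the previous player has a winning strategy. A move is redundant if removing it from the rule-set does not change the set of $\mathcal{P}$-positions. *)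

theory Defs
  imports Main
begin

type_synonym pos = "nat \<times> nat"
type_synonym move = "nat \<times> nat"

definition wythoff_moves :: "move set" where
  "wythoff_moves = {m. \<exists>i\<ge>1. m = (i, 0) \<or> m = (0, i) \<or> m = (i, i)}"

(* The side conditions on u and v keep the truncated subtraction on nat exact. *)
definition options :: "move set \<Rightarrow> pos \<Rightarrow> pos set" where
  "options M p = {(fst p - u, snd p - v) | u v. (u, v) \<in> M \<and> u \<le> fst p \<and> v \<le> snd p}"

lemma options_finite: "finite (options M p)"
proof (rule finite_subset)
  show "options M p \<subseteq> {..fst p} \<times> {..snd p}"
    by (auto simp: options_def)
qed simp

(* Every admissible block is finite by options_finite, so card has its intended meaning here. *)
definition admissible_block :: "nat \<Rightarrow> move set \<Rightarrow> pos \<Rightarrow> pos set \<Rightarrow> bool" where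
  "admissible_block k M p S \<longleftrightarrow> S \<subseteq> options M p \<and> card S \<le> k - 1"

(* prev_wins k M p: with no block declared yet at p, the previous player has a winning strategy.
   next_wins k M p: in the same situation, the player about to move has one.
   A derivation is a winning strategy: an existential premise is a choice by the strategy's owner
   (a block S, or an option q in reply to a given block), a universal premise ranges over all
   choices of the opponent.  After a move to q the mover is the previous player at q.
   If no unblocked option is left, the player about to move loses: the premise of prev_wins
   then holds vacuously and the existential in next_wins fails. *)
inductive prev_wins :: "nat \<Rightarrow> move set \<Rightarrow> pos \<Rightarrow> bool"
  and next_wins :: "nat \<Rightarrow> move set \<Rightarrow> pos \<Rightarrow> bool"
  for k :: nat and M :: "move set"
where
  prev_winsI:
    "\<exists>S. admissible_block k M p S \<and> (\<forall>q \<in> options M p - S. next_wins k M q)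
      \<Longrightarrow> prev_wins k M p"
| next_winsI:
    "\<forall>S. admissible_block k M p S \<longrightarrow> (\<exists>q \<in> options M p - S. prev_wins k M q)
      \<Longrightarrow> next_wins k M p"

definition P_positions :: "nat \<Rightarrow> move set \<Rightarrow> pos set" where
  "P_positions k M = {p. prev_wins k M p}"

definition redundant :: "nat \<Rightarrow> move set \<Rightarrow> move \<Rightarrow> bool" where
  "redundant k M m \<longleftrightarrow> P_positions k (M - {m}) = P_positions k M"

end

theory Submission
  imports Defs Complex_Main
begin

text \<open>
  A position is a P-position of \<open>W^k\<close> iff fewer than \<open>k\<close> of its options are P-positions, and this
  determines the P-positions. Hence a move \<open>m\<close> is not redundant as soon as some position \<open>p\<close> has exactly
  \<open>k\<close> P-options, one of them being \<open>p - m\<close>: without \<open>m\<close>, all the others could be blocked.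

  Up to symmetry, the P-positions of \<open>W^3\<close> are \<open>(0, 0)\<close>, \<open>(n, 2n + 1)\<close> and \<open>(n, 2n + 2)\<close>; those of
  \<open>W^2\<close> are \<open>(0, 0)\<close>, \<open>(n, 2n + 1)\<close> and \<open>(2a + 2, 2b + 2)\<close> for the Wythoff pairs \<open>(a, b)\<close>,
  i.e. the P-positions of ordinary Wythoff Nim.
  For the move \<open>(i, 0)\<close> the witness \<open>p\<close> is \<open>(i + k - 1, 0)\<close>. For \<open>(i, i)\<close> it is \<open>(i, i)\<close> itself when
  \<open>k = 3\<close>. When \<open>k = 2\<close> and \<open>i\<close> is odd, it is \<open>(3i, 5i + 1)\<close>, which works because \<open>5/3\<close> exceeds the golden
  ratio; when \<open>i = 2h + 2\<close>, it is \<open>(i, i)\<close> or \<open>(i + 2, i + 2)\<close>, since \<open>h\<close> and \<open>h + 1\<close> are not both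
  larger members of Wythoff pairs.
\<close>

section \<open>P-positions by counting\<close>

lemma options_sum_less:
  assumes "(0, 0) \<notin> M" "q \<in> options M p"
  shows "fst q + snd q < fst p + snd p"
proof -
  obtain u v where uv: "q = (fst p - u, snd p - v)" "(u, v) \<in> M" "u \<le> fst p" "v \<le> snd p"
    using assms(2) by (auto simp: options_def)
  then have "u \<noteq> 0 \<or> v \<noteq> 0"
    using assms(1) by metis
  then show ?thesis
    using uv by auto
qed

text \<open>Least fixed points alone could leave a position undecided if play went on forever.
  Nonzero moves lower the coordinate sum, and once all options are decided the two introduction
  rules are negations of each other.\<close>

lemma next_wins_iff_not_prev_wins:
  assumes "(0, 0) \<notin> M"
  shows "next_wins k M p \<longleftrightarrow> \<not> prev_wins k M p"
proof (induction "fst p + snd p" arbitrary: p rule: less_induct)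
  case less
  have IH: "next_wins k M q \<longleftrightarrow> \<not> prev_wins k M q" if "q \<in> options M p" for q
    using less options_sum_less[OF assms that] by blast
  show ?case
    unfolding next_wins.simps[of k M p] prev_wins.simps[of k M p]
    using IH by blast
qed

text \<open>A mover wins by reaching a P-position, so a winning block has to cover all P-options;
  the P-options themselves are the smallest such block.\<close>

lemma P_positions_iff:
  assumes "(0, 0) \<notin> M" "0 < k"
  shows "p \<in> P_positions k M \<longleftrightarrow> card (options M p \<inter> P_positions k M) < k"
proof -
  let ?A = "options M p \<inter> P_positions k M"
  have "p \<in> P_positions k M \<longleftrightarrow>
      (\<exists>S. admissible_block k M p S \<and> (\<forall>q \<in> options M p - S. \<not> prev_wins k M q))"
    unfolding P_positions_def mem_Collect_eq
    by (subst prev_wins.simps) (simp add: next_wins_iff_not_prev_wins[OF assms(1)])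
  also have "\<dots> \<longleftrightarrow> (\<exists>S. admissible_block k M p S \<and> ?A \<subseteq> S)"
    by (auto simp: P_positions_def)
  also have "\<dots> \<longleftrightarrow> card ?A \<le> k - 1"
  proof
    assume "\<exists>S. admissible_block k M p S \<and> ?A \<subseteq> S"
    then obtain S where S: "S \<subseteq> options M p" "card S \<le> k - 1" "?A \<subseteq> S"
      by (auto simp: admissible_block_def)
    then have "card ?A \<le> card S"
      by (meson card_mono finite_subset options_finite)
    then show "card ?A \<le> k - 1"
      using S by simp
  next
    assume "card ?A \<le> k - 1"
    then show "\<exists>S. admissible_block k M p S \<and> ?A \<subseteq> S"
      by (intro exI[of _ ?A]) (auto simp: admissible_block_def)
  qed
  finally show ?thesis
    using assms(2) by auto
qed

text \<open>The counting condition at \<open>p\<close> looks only at positions of smaller coordinate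
  sum, so it has at most one solution.\<close>

lemma P_positions_eqI:
  assumes "(0, 0) \<notin> M" "0 < k"
    and "\<And>p. p \<in> Q \<longleftrightarrow> card (options M p \<inter> Q) < k"
  shows "P_positions k M = Q"
proof -
  have "p \<in> P_positions k M \<longleftrightarrow> p \<in> Q" for p
  proof (induction "fst p + snd p" arbitrary: p rule: less_induct)
    case less
    then have "options M p \<inter> P_positions k M = options M p \<inter> Q"
      using options_sum_less[OF assms(1)] by blast
    then show ?case
      using P_positions_iff[OF assms(1,2), of p] assms(3)[of p] by simp
  qed
  then show ?thesis
    by blast
qed

lemma not_redundantI:
  assumes "(0, 0) \<notin> M" "0 < k" "(u, v) \<in> M"
    and card: "card (options M (x + u, y + v) \<inter> P_positions k M) = k"
    and P: "(x, y) \<in> P_positions k M"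
  shows "\<not> redundant k M (u, v)"
proof
  let ?M = "M - {(u, v)}" and ?p = "(x + u, y + v)" and ?P = "P_positions k M"
  assume "redundant k M (u, v)"
  then have eq: "P_positions k ?M = ?P"
    by (simp add: redundant_def)
  have "(x, y) \<in> options M ?p"
    using assms(3) by (force simp: options_def)
  then have mem: "(x, y) \<in> options M ?p \<inter> ?P"
    using P by blast
  \<comment> \<open>Subtraction is exact here, so \<open>(u, v)\<close> is the only move from
    \<open>?p\<close> to \<open>(x, y)\<close>.\<close>
  have "options ?M ?p \<subseteq> options M ?p - {(x, y)}"
    by (auto simp: options_def)
  then have "card (options ?M ?p \<inter> ?P) \<le> card (options M ?p \<inter> ?P - {(x, y)})"
    by (intro card_mono) (auto simp: options_finite)
  also have "\<dots> < k"
    using mem card assms(2) by (simp add: options_finite card_Diff_singleton)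
  finally have "?p \<in> P_positions k ?M"
    using P_positions_iff[of ?M k ?p] assms(1,2) eq by simp
  moreover have "?p \<notin> ?P"
    using P_positions_iff[OF assms(1,2), of ?p] card by simp
  ultimately show False
    using eq by simp
qed

section \<open>Wythoff moves\<close>

lemma zero_notin_wythoff_moves: "(0, 0) \<notin> wythoff_moves"
  by (auto simp: wythoff_moves_def)

lemma mem_options_wythoff:
  "(a, b) \<in> options wythoff_moves (x, y) \<longleftrightarrow>
    (a < x \<and> b = y) \<or> (a = x \<and> b < y) \<or> (a < x \<and> b < y \<and> a + y = b + x)"
proof
  assume "(a, b) \<in> options wythoff_moves (x, y)"
  then show "(a < x \<and> b = y) \<or> (a = x \<and> b < y) \<or> (a < x \<and> b < y \<and> a + y = b + x)"
    by (auto simp: options_def wythoff_moves_def)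
next
  assume *: "(a < x \<and> b = y) \<or> (a = x \<and> b < y) \<or> (a < x \<and> b < y \<and> a + y = b + x)"
  have "(x - a, y - b) \<in> wythoff_moves"
    unfolding wythoff_moves_def mem_Collect_eq
    \<comment> \<open>The nonzero differences agree in all three directions, so their maximum is the
      step length.\<close>
    by (rule exI[of _ "max (x - a) (y - b)"]) (use * in auto)
  then show "(a, b) \<in> options wythoff_moves (x, y)"
    using * unfolding options_def by (intro CollectI exI[of _ "x - a"] exI[of _ "y - b"]) auto
qed

text \<open>Swapping coordinates preserves both the Wythoff options and \<open>Q\<close>, so
  counting on one side of the main diagonal is enough.\<close>

lemma kernel_count_sym:
  assumes sym: "\<And>x y. (x, y) \<in> Q \<longleftrightarrow> (y, x) \<in> Q"
    and le: "\<And>x y. x \<le> y \<Longrightarrow> (x, y) \<in> Q \<longleftrightarrow> card (options wythoff_moves (x, y) \<inter> Q) < k"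
  shows "p \<in> Q \<longleftrightarrow> card (options wythoff_moves p \<inter> Q) < k"
proof -
  obtain x y where p: "p = (x, y)"
    by force
  have "prod.swap ` (options wythoff_moves (x, y) \<inter> Q) = options wythoff_moves (y, x) \<inter> Q"
  proof (intro set_eqI)
    fix q
    show "q \<in> prod.swap ` (options wythoff_moves (x, y) \<inter> Q) \<longleftrightarrow>
        q \<in> options wythoff_moves (y, x) \<inter> Q"
      using sym by (cases q) (auto simp: mem_options_wythoff image_iff Bex_def)
  qed
  then have "card (options wythoff_moves (y, x) \<inter> Q) = card (options wythoff_moves (x, y) \<inter> Q)"
    by (metis card_image inj_swap inj_on_subset subset_UNIV)
  then show ?thesis
    using le[of x y] le[of y x] sym[of x y] p by (cases "x \<le> y") auto
qed

lemma nat_parity_cases: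
  fixes x :: nat
  obtains "x = 0" | n where "x = 2 * n + 1" | n where "x = 2 * n + 2"
proof -
  have "x = 0 \<or> (\<exists>n. x = 2 * n + 1) \<or> (\<exists>n. x = 2 * n + 2)"
    by presburger
  then show thesis
    using that by blast
qed

lemma card_ge_2I:
  assumes "finite A" "a \<in> A" "b \<in> A" "a \<noteq> b"
  shows "2 \<le> card A"
  using card_mono[of A "{a, b}"] assms by simp

lemma card_ge_3I:
  assumes "finite A" "a \<in> A" "b \<in> A" "c \<in> A" "a \<noteq> b" "a \<noteq> c" "b \<noteq> c"
  shows "3 \<le> card A"
  using card_mono[of A "{a, b, c}"] assms by simp

section \<open>The game with \<open>k = 3\<close>\<close>

definition P3 :: "pos set" where
  "P3 = {(x, y). (x = 0 \<and> y = 0) \<or> y = 2 * x + 1 \<or> y = 2 * x + 2 \<or> x = 2 * y + 1 \<or> x = 2 * y + 2}"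

text \<open>Each column holds three P-points, at heights \<open>(x - 1) div 2\<close>,
  \<open>2 * x + 1\<close> and \<open>2 * x + 2\<close>. Above height \<open>2 * x + 2\<close> all
  three are options; otherwise a non-P-position has one P-option in each of the three
  directions.\<close>

lemma P3_count:
  assumes "x \<le> y"
  shows "(x, y) \<in> P3 \<longleftrightarrow> card (options wythoff_moves (x, y) \<inter> P3) < 3"
proof
  assume P: "(x, y) \<in> P3"
  let ?A = "options wythoff_moves (x, y) \<inter> P3"
  have "\<exists>a b. ?A \<subseteq> {a, b}"
  proof -
    consider "x = 0" "y = 0" | "y = 2 * x + 1" | "y = 2 * x + 2"
      using P assms by (auto simp: P3_def)
    then show ?thesis
    proof cases
      case 1
      then have "?A = {}" by (auto simp: mem_options_wythoff)
      then show ?thesis by simp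
    next
      case 2
      \<comment> \<open>The second point is the one of the form \<open>(n, 2 * n + 2)\<close> on the
        same diagonal.\<close>
      have "?A \<subseteq> {(x, (x - 1) div 2), (x - 1, 2 * x)}"
        using 2 by (auto simp: mem_options_wythoff P3_def; presburger)
      then show ?thesis by blast
    next
      case 3
      have "?A \<subseteq> {(x, (x - 1) div 2), (x, 2 * x + 1)}"
        using 3 by (auto simp: mem_options_wythoff P3_def; presburger)
      then show ?thesis by blast
    qed
  qed
  then obtain a b where "?A \<subseteq> {a, b}"
    by blast
  then have "card ?A \<le> card {a, b}"
    by (intro card_mono) auto
  also have "\<dots> < 3"
    by (simp add: card_insert_if)
  finally show "card ?A < 3" .
next
  let ?A = "options wythoff_moves (x, y) \<inter> P3"
  have fin: "finite ?A"
    by (simp add: options_finite)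
  assume "card ?A < 3"
  moreover have "3 \<le> card ?A" if N: "(x, y) \<notin> P3"
  proof -
    \<comment> \<open>For \<open>x = 0\<close> truncated subtraction gives \<open>l = 0\<close>,
      which is the P-point at the origin.\<close>
    define l where "l = (x - 1) div 2"
    have l: "x = 0 \<or> x = 2 * l + 1 \<or> x = 2 * l + 2"
      unfolding l_def by presburger
    show ?thesis
    proof (cases "2 * x + 2 < y")
      case True
      show ?thesis
      proof (rule card_ge_3I[OF fin])
        show "(x, l) \<in> ?A" "(x, 2 * x + 1) \<in> ?A" "(x, 2 * x + 2) \<in> ?A"
          using True l by (auto simp: mem_options_wythoff P3_def l_def)
      qed (use l in \<open>auto simp: l_def\<close>)
    next
      case False
      then have y: "y \<le> 2 * x" "0 < x"
        using N assms by (auto simp: P3_def)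
      define r where "r = (y - 1) div 2"
      have r: "y = 2 * r + 1 \<or> y = 2 * r + 2"
        unfolding r_def using y assms by presburger
      have "(x, l) \<in> ?A" "(r, y) \<in> ?A"
        using y l r assms by (auto simp: mem_options_wythoff P3_def)
      moreover have "\<exists>a b. (a, b) \<in> ?A \<and> a < x \<and> b < y"
      proof (cases "y = x")
        case True
        then show ?thesis
          using y by (intro exI[of _ 0]) (auto simp: mem_options_wythoff P3_def)
      next
        case False
        then show ?thesis
          using y assms
          \<comment> \<open>This is the point of the line \<open>b = 2 * a + 1\<close> on the
            diagonal of difference \<open>y - x\<close>; it lies left of \<open>x\<close> because
            \<open>y \<le> 2 * x\<close>.\<close>
          by (intro exI[of _ "y - x - 1"] exI[of _ "2 * (y - x - 1) + 1"])
             (auto simp: mem_options_wythoff P3_def)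
      qed
      ultimately show ?thesis
        using card_ge_3I[OF fin, of "(x, l)" "(r, y)"] r assms y
        by (metis (no_types, lifting) nat_neq_iff prod.inject IntE mem_options_wythoff)
    qed
  qed
  ultimately show "(x, y) \<in> P3"
    by fastforce
qed

lemma P_positions_3: "P_positions 3 wythoff_moves = P3"
  by (rule P_positions_eqI[OF zero_notin_wythoff_moves], simp, rule kernel_count_sym)
     (auto simp: P3_count, auto simp: P3_def)

section \<open>Witness positions for three\<close>

lemma not_redundant_3:
  assumes "m \<in> wythoff_moves"
  shows "\<not> redundant 3 wythoff_moves m"
proof -
  note I = not_redundantI[OF zero_notin_wythoff_moves, of 3, unfolded P_positions_3]
  obtain i where i: "1 \<le> i" "m = (i, 0) \<or> m = (0, i) \<or> m = (i, i)"
    using assms by (auto simp: wythoff_moves_def)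
  consider "m = (i, 0)" | "m = (0, i)" | "m = (i, i)"
    using i(2) by blast
  then show ?thesis
  proof cases
    case 1
    \<comment> \<open>The sums exhibit \<open>(2, 0)\<close> as the position reached by the removed
      move.\<close>
    have "options wythoff_moves (2 + i, 0 + 0) \<inter> P3 = {(0, 0), (1, 0), (2, 0)}"
      using i by (auto simp: mem_options_wythoff P3_def)
    then show ?thesis
      using I[of i 0 2 0] assms 1 by (simp add: P3_def)
  next
    case 2
    have "options wythoff_moves (0 + 0, 2 + i) \<inter> P3 = {(0, 0), (0, 1), (0, 2)}"
      using i by (auto simp: mem_options_wythoff P3_def)
    then show ?thesis
      using I[of 0 i 0 2] assms 2 by (simp add: P3_def)
  next
    case 3
    define l where "l = (i - 1) div 2"
    have "i = 2 * l + 1 \<or> i = 2 * l + 2"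
      unfolding l_def using i(1) by presburger
    then have "options wythoff_moves (0 + i, 0 + i) \<inter> P3 = {(0, 0), (i, l), (l, i)}" "l < i"
      by (auto simp: mem_options_wythoff P3_def)
    then show ?thesis
      using I[of i i 0 0] assms 3 i by (simp add: P3_def)
  qed
qed

section \<open>The lower Wythoff sequence\<close>

definition golden :: real where
  "golden = (1 + sqrt 5) / 2"

lemma golden_square: "golden\<^sup>2 = golden + 1"
  by (simp add: golden_def power2_eq_square field_simps)

lemma golden_bounds: "8 / 5 < golden" "golden < 5 / 3"
proof -
  have "11 / 5 < sqrt 5" "sqrt 5 < 7 / 3"
    by (rule real_less_rsqrt real_less_lsqrt; simp add: power2_eq_square)+
  then show "8 / 5 < golden" "golden < 5 / 3"
    by (auto simp: golden_def)
qed

text \<open>Infinite descent: a solution \<open>(n, k)\<close> with \<open>k > 0\<close> has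
  \<open>k < n\<close>, and then \<open>(k, n - k)\<close> is a smaller solution of the same
  kind.\<close>

lemma golden_diophantine: "(n::nat)\<^sup>2 = n * k + k\<^sup>2 \<Longrightarrow> k = 0"
proof (induction n arbitrary: k rule: less_induct)
  case (less n)
  show ?case
  proof (rule ccontr)
    assume "k \<noteq> 0"
    have "k < n"
    proof (rule ccontr)
      assume "\<not> k < n"
      then have "n * n \<le> n * k"
        by simp
      moreover have "0 < k * k"
        using \<open>k \<noteq> 0\<close> by simp
      ultimately show False
        using less.prems by (simp only: power2_eq_square)
    qed
    then obtain l where l: "n = k + l" "0 < l"
      using less_imp_add_positive by blast
    then have "k\<^sup>2 = k * l + l\<^sup>2"
      using less.prems by (simp add: power2_eq_square algebra_simps)
    then show False
      using less.IH[OF \<open>k < n\<close>] l by blast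
  qed
qed

lemma golden_irrational:
  assumes "0 < k"
  shows "real n \<noteq> real k * golden"
proof
  assume n: "real n = real k * golden"
  then have "(real n)\<^sup>2 = (real k)\<^sup>2 * (golden + 1)"
    by (simp add: power_mult_distrib golden_square)
  also have "\<dots> = real n * real k + (real k)\<^sup>2"
    by (simp add: n power2_eq_square algebra_simps)
  finally have "n\<^sup>2 = n * k + k\<^sup>2"
    by (simp flip: of_nat_mult of_nat_add of_nat_power)
  then show False
    using golden_diophantine assms by blast
qed

section \<open>Beatty's theorem for the golden ratio\<close>

definition wlow :: "nat \<Rightarrow> nat" where
  "wlow k = nat \<lfloor>real k * golden\<rfloor>"

lemma wlow_eq_iff: "wlow k = n \<longleftrightarrow> real n \<le> real k * golden \<and> real k * golden < real n + 1"
proof -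
  have "0 \<le> real k * golden"
    using golden_bounds by simp
  then have "wlow k = n \<longleftrightarrow> \<lfloor>real k * golden\<rfloor> = int n"
    by (auto simp: wlow_def)
  then show ?thesis
    by (simp add: floor_eq_iff)
qed

lemma wlow_bounds: "real (wlow k) \<le> real k * golden" "real k * golden < real (wlow k) + 1"
  using wlow_eq_iff by blast+

lemma wlow_0 [simp]: "wlow 0 = 0"
  by (simp add: wlow_def)

lemma wlow_less:
  assumes "k < l"
  shows "wlow k < wlow l"
proof -
  have "real k * golden + golden \<le> real l * golden"
    using assms golden_bounds mult_right_mono[of "real k + 1" "real l" golden]
    by (simp add: algebra_simps)
  then have "real (wlow k) < real (wlow l)"
    using wlow_bounds[of k] wlow_bounds[of l] golden_bounds by linarith
  then show ?thesis
    by simp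
qed

lemma wlow_eq_iff_eq [simp]: "wlow k = wlow l \<longleftrightarrow> k = l"
  using wlow_less by (metis linorder_neqE_nat less_irrefl)

text \<open>Twice the golden ratio exceeds 3. This is the form of the bound that
  \<open>partner_ratio\<close> needs.\<close>

lemma wlow_ge: "3 * k \<le> 2 * wlow k + 1"
proof (cases "k < 5")
  case True
  then have "k = 0 \<or> k = 1 \<or> k = 2 \<or> k = 3 \<or> k = 4"
    by auto
  then have "real (3 * k) < real (2 * wlow k + 1) + 1"
    using wlow_bounds[of k] golden_bounds by auto
  then show ?thesis
    by linarith
next
  case False
  then have "real k * (8 / 5) \<le> real k * golden"
    using golden_bounds by (intro mult_left_mono) auto
  then have "real (3 * k) < real (2 * wlow k + 1) + 1"
    using wlow_bounds[of k] False by linarith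
  then show ?thesis
    by linarith
qed

lemma wlow_ge_self: "k \<le> wlow k"
  using wlow_ge[of k] by linarith

text \<open>Beatty's theorem for the golden ratio \<open>g\<close>. With \<open>t = n / g = n (g - 1)\<close>, the number \<open>n\<close> is a
  lower term iff the distance from \<open>t\<close> up to the next integer is below \<open>1 / g = g - 1\<close>, and an
  upper term iff that distance exceeds \<open>g - 1\<close>.\<close>

lemma wlow_cover: "(\<exists>k. n = wlow k) \<or> (\<exists>k>0. n = wlow k + k)"
proof (cases "n = 0")
  case True
  then show ?thesis
    by (intro disjI1 exI[of _ 0]) simp
next
  case False
  define t where "t = real n * (golden - 1)"
  define c where "c = nat \<lceil>t\<rceil>"
  have g: "golden * (golden - 1) = 1"
    using golden_square by (simp add: power2_eq_square algebra_simps)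
  have tg: "t * golden = real n"
    using g by (simp add: t_def mult.assoc mult.commute[of _ golden])
  have "0 < t" "t < real n"
    using False golden_bounds by (auto simp: t_def)
  then have c: "t \<le> real c" "real c < t + 1" "0 < c"
    unfolding c_def by linarith+
  show ?thesis
  proof (cases "real c < t + (golden - 1)")
    case True
    have "t * golden \<le> real c * golden" "real c * golden < (t + (golden - 1)) * golden"
      using c True golden_bounds by (auto intro: mult_right_mono mult_strict_right_mono)
    then have "wlow c = n"
      using tg g by (auto simp: wlow_eq_iff algebra_simps)
    then show ?thesis
      by blast
  next
    case False
    have "c \<le> n"
      using c \<open>t < real n\<close> by (metis ceiling_le_iff c_def nat_le_iff of_int_of_nat_eq less_imp_le)
    have ne: "real c \<noteq> t + (golden - 1)"
    proof
      assume "real c = t + (golden - 1)"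
      then have "real c * golden = real n + 1"
        using tg g by algebra
      then show False
        using golden_irrational[OF \<open>0 < c\<close>, of "n + 1"] by simp
    qed
    \<comment> \<open>With \<open>g\<close> the golden ratio, \<open>1 / g + 1 / g^2 = 1\<close>, so
      \<open>n / g^2 = n - t\<close>, and \<open>k\<close> is the next integer above it. Multiplying
      the bounds on \<open>k\<close> by \<open>g^2 = g + 1\<close>, where
      \<open>2 - g = 1 / g^2\<close>, puts \<open>n\<close> just below
      \<open>k * g^2\<close>.\<close>
    define k where "k = n + 1 - c"
    have k: "real k = real n + 1 - real c"
      using \<open>c \<le> n\<close> by (simp add: k_def of_nat_diff)
    have lo: "real n - t < real k" and hi: "real k < real n - t + 2 - golden"
      using False ne c k by auto
    have g2: "golden * golden = golden + 1"
      using golden_square by (simp add: power2_eq_square)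
    have "(real n - t) * (golden + 1) = real n"
      using tg by (simp add: t_def algebra_simps g2)
    moreover have "(2 - golden) * (golden + 1) = 1"
      by (simp add: algebra_simps g2)
    moreover have "(real n - t) * (golden + 1) < real k * (golden + 1)"
      using lo golden_bounds by (intro mult_strict_right_mono) auto
    moreover have "real k * (golden + 1) < (real n - t + (2 - golden)) * (golden + 1)"
      using hi golden_bounds by (intro mult_strict_right_mono) auto
    moreover have "(real n - t + (2 - golden)) * (golden + 1)
        = (real n - t) * (golden + 1) + (2 - golden) * (golden + 1)"
      by (rule distrib_right)
    ultimately have "real n < real k * (golden + 1)" "real k * (golden + 1) < real n + 1"
      by linarith+
    then have "real n \<le> real k * golden + real k" "real k * golden + real k < real n + 1"
      by (simp_all add: distrib_left)
    moreover have "k \<le> n"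
      using \<open>0 < c\<close> by (simp add: k_def)
    ultimately have "wlow k = n - k"
      by (auto simp: wlow_eq_iff of_nat_diff)
    moreover have "0 < k"
      using \<open>c \<le> n\<close> by (simp add: k_def)
    ultimately show ?thesis
      using \<open>k \<le> n\<close> by (intro disjI2 exI[of _ k]) auto
  qed
qed

text \<open>The disjointness half of Beatty's theorem. With \<open>g\<close> the golden ratio, a
  common value \<open>n\<close> with \<open>l > 0\<close> satisfies
  \<open>n \<le> k * g < n + 1\<close> and \<open>n < l * g^2 < n + 1\<close>; scaling by
  \<open>1 / g = g - 1\<close> and \<open>1 / g^2 = 2 - g\<close> and adding puts the integer
  \<open>k + l\<close> strictly between \<open>n\<close> and \<open>n + 1\<close>.\<close>

lemma wlow_eq_upper:
  assumes "wlow k = wlow l + l"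
  shows "l = 0"
proof (rule ccontr)
  assume "l \<noteq> 0"
  define n where "n = wlow k"
  have g2: "golden * golden = golden + 1"
    using golden_square by (simp add: power2_eq_square)
  have "real n \<le> real k * golden" "real k * golden < real n + 1"
    using wlow_bounds[of k] by (simp_all add: n_def)
  then have k: "real n * (golden - 1) \<le> real k * golden * (golden - 1)"
      "real k * golden * (golden - 1) < (real n + 1) * (golden - 1)"
    using golden_bounds by (auto intro: mult_right_mono mult_strict_right_mono)
  have "real n \<le> real l * golden + real l" "real l * golden + real l < real n + 1"
    using wlow_bounds[of l] assms by (simp_all add: n_def)
  moreover have "real n \<noteq> real l * golden + real l"
    using golden_irrational[of l "n - l"] \<open>l \<noteq> 0\<close> assms by (auto simp: n_def)
  ultimately have l: "real n * (2 - golden) < (real l * golden + real l) * (2 - golden)"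
      "(real l * golden + real l) * (2 - golden) < (real n + 1) * (2 - golden)"
    using golden_bounds by (auto intro: mult_strict_right_mono)
  have "real k * golden * (golden - 1) = real k"
    "(real l * golden + real l) * (2 - golden) = real l"
    using g2 by algebra+
  moreover have "real n * (golden - 1) + real n * (2 - golden) = real n"
    "(real n + 1) * (golden - 1) + (real n + 1) * (2 - golden) = real n + 1"
    by (simp_all add: algebra_simps)
  ultimately have "real n < real k + real l" "real k + real l < real n + 1"
    using add_le_less_mono[OF k(1) l(1)] add_strict_mono[OF k(2) l(2)] by (simp_all only:)
  then have "real n < real (k + l)" "real (k + l) < real (n + 1)"
    by simp_all
  then show False
    unfolding of_nat_less_iff by linarith
qed

text \<open>Raising the index raises both summands, so distinct upper terms differ by at least
  2.\<close>

lemma wlow_upper_not_consecutive: "wlow k + k + 1 \<noteq> wlow l + l"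
proof
  assume eq: "wlow k + k + 1 = wlow l + l"
  consider "k < l" | "k = l" | "l < k"
    by linarith
  then show False
    using eq wlow_less[of k l] wlow_less[of l k] by cases auto
qed

section \<open>Wythoff pairs\<close>

text \<open>The P-positions of ordinary Wythoff Nim; \<open>k = 0\<close> pairs 0 with
  itself.\<close>

definition wpair :: "nat \<Rightarrow> nat \<Rightarrow> bool" where
  "wpair m n \<longleftrightarrow> (\<exists>k. (m = wlow k \<and> n = wlow k + k) \<or> (n = wlow k \<and> m = wlow k + k))"

definition partner :: "nat \<Rightarrow> nat" where
  "partner m = (THE n. wpair m n)"

lemma wpair_sym: "wpair m n \<Longrightarrow> wpair n m"
  unfolding wpair_def by blast

lemma wpair_unique:
  assumes "wpair m n" "wpair m n'"
  shows "n = n'"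
proof -
  have mixed: "wlow k = wlow l + l \<Longrightarrow> l = 0 \<and> k = 0" for k l
    using wlow_eq_upper[of k l] wlow_ge_self[of k] by auto
  have upper: "wlow k + k = wlow l + l \<Longrightarrow> k = l" for k l
    using wlow_less[of k l] wlow_less[of l k] by (cases k l rule: linorder_cases) auto
  obtain k l where k: "m = wlow k \<and> n = wlow k + k \<or> n = wlow k \<and> m = wlow k + k"
    and l: "m = wlow l \<and> n' = wlow l + l \<or> n' = wlow l \<and> m = wlow l + l"
    using assms unfolding wpair_def by blast
  from k l consider "wlow k = wlow l" "n = wlow k + k" "n' = wlow l + l"
    | "wlow k = wlow l + l" "n = wlow k + k" "n' = wlow l"
    | "wlow l = wlow k + k" "n = wlow k" "n' = wlow l + l"
    | "wlow k + k = wlow l + l" "n = wlow k" "n' = wlow l"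
    by metis
  then show ?thesis
  proof cases
    case 1
    then have "k = l"
      by (simp only: wlow_eq_iff_eq)
    then show ?thesis
      using 1 by blast
  next
    case 2
    then show ?thesis
      using mixed by auto
  next
    case 3
    then show ?thesis
      using mixed by auto
  next
    case 4
    then show ?thesis
      using upper by blast
  qed
qed

lemma wpair_ex: "\<exists>n. wpair m n"
  using wlow_cover[of m] by (auto simp: wpair_def)

lemma wpair_iff: "wpair m n \<longleftrightarrow> partner m = n"
  using wpair_ex wpair_unique unfolding partner_def by (metis theI)

lemma partner_partner [simp]: "partner (partner m) = m"
  using wpair_sym wpair_iff by metis

lemma wlow_partner: "partner (wlow k) = wlow k + k"
proof -
  have "wpair (wlow k) (wlow k + k)"
    by (auto simp: wpair_def)
  then show ?thesis
    by (simp add: wpair_iff)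
qed

lemma partner_cases:
  obtains k where "m = wlow k" "partner m = wlow k + k"
  | k where "0 < k" "m = wlow k + k" "partner m = wlow k"
proof -
  have "wpair m (partner m)"
    by (simp add: wpair_iff)
  then obtain k where k: "m = wlow k \<and> partner m = wlow k + k \<or> partner m = wlow k \<and> m = wlow k + k"
    by (auto simp: wpair_def)
  show thesis
    using k that by (cases "k = 0") auto
qed

lemma partner_le: "partner m \<le> 2 * m"
  by (rule partner_cases[of m]) (use wlow_ge_self in auto)

lemma partner_ge: "m \<le> 2 * partner m"
  using partner_le[of "partner m"] by simp

lemma partner_0 [simp]: "partner 0 = 0"
  using partner_le[of 0] by simp

lemma partner_ratio: "3 * m \<le> 5 * partner m + 1"
proof (rule partner_cases[of m])
  fix k assume "0 < k" "m = wlow k + k" "partner m = wlow k"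
  then show ?thesis
    using wlow_ge[of k] by simp
qed auto

text \<open>The difference of a Wythoff pair is its index, so it determines the pair.\<close>

lemma partner_diff_unique:
  assumes "partner a = a + d" "partner b = b + d"
  shows "a = b"
proof -
  have "a = wlow d" if "partner a = a + d" for a
    by (rule partner_cases[of a]) (use that in auto)
  then show ?thesis
    using assms by blast
qed

lemma partner_Suc_ge:
  assumes "partner m < m"
  shows "m + 1 \<le> partner (m + 1)"
proof -
  obtain k where k: "m = wlow k + k"
    by (rule partner_cases[of m]) (use assms in auto)
  show ?thesis
    by (rule partner_cases[of "m + 1"]) (use k wlow_upper_not_consecutive in auto)
qed

text \<open>In Wythoff Nim a non-P-position has a move to a P-position. If the pair in the column is
  not below, then \<open>m = wlow k\<close> with \<open>n - m < k\<close>, so the pair of index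
  \<open>n - m\<close> sits further down the diagonal.\<close>

lemma partner_absorbing:
  assumes "m \<le> n" "partner m \<noteq> n"
  shows "partner m < n \<or> (\<exists>a<m. partner a = a + (n - m))"
proof (cases "partner m < n")
  case False
  obtain k where "m = wlow k" "n < m + k"
    by (rule partner_cases[of m]) (use False assms in auto)
  then have "wlow (n - m) < m"
    using wlow_less[of "n - m" k] assms(1) by simp
  then show ?thesis
    using wlow_partner by blast
qed simp

section \<open>The game with \<open>k = 2\<close>\<close>

definition P2 :: "pos set" where
  "P2 = {(x, y). (x = 0 \<and> y = 0) \<or> y = 2 * x + 1 \<or> x = 2 * y + 1 \<or>
    (\<exists>m. x = 2 * m + 2 \<and> y = 2 * partner m + 2)}"

text \<open>The two ratio bounds keep the even points strictly between the two odd lines, in a form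
  fit for linear arithmetic.\<close>

lemma P2_cases:
  assumes "(x, y) \<in> P2"
  obtains "x = 0" "y = 0" | "y = 2 * x + 1" | "x = 2 * y + 1"
  | m n where "x = 2 * m + 2" "y = 2 * n + 2" "wpair m n" "m \<le> 2 * n" "n \<le> 2 * m"
proof -
  consider "x = 0" "y = 0" | "y = 2 * x + 1" | "x = 2 * y + 1"
    | m where "x = 2 * m + 2" "y = 2 * partner m + 2"
    using assms by (auto simp: P2_def)
  then show thesis
  proof cases
    case (4 m)
    then show thesis
      using that(4)[of m "partner m"] partner_le partner_ge by (simp add: wpair_iff)
  qed (use that in auto)
qed

lemma P2_sym: "(x, y) \<in> P2 \<longleftrightarrow> (y, x) \<in> P2"
proof -
  have "(y, x) \<in> P2" if "(x, y) \<in> P2" for x y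
    using that
  proof (cases rule: P2_cases)
    case (4 m n)
    then have "partner n = m"
      using wpair_sym wpair_iff by blast
    then show ?thesis
      using 4 by (auto simp: P2_def)
  qed (auto simp: P2_def)
  then show ?thesis
    by blast
qed

text \<open>Parity leaves one candidate. On \<open>y = 2 * x + 1\<close> it lies in the same column:
  on the other line for odd \<open>x\<close>, a doubled Wythoff pair for even \<open>x > 0\<close>.
  For a doubled pair off the main diagonal it is the point of that line on the same
  diagonal.\<close>

lemma P2_options_subset:
  assumes P: "(x, y) \<in> P2" and le: "x \<le> y"
  shows "\<exists>q. options wythoff_moves (x, y) \<inter> P2 \<subseteq> {q}"
proof -
  have *: ?thesis
    if "\<And>a b. (a, b) \<in> P2 \<Longrightarrow> (a < x \<and> b = y) \<or> (a = x \<and> b < y) \<or> (a < x \<and> b < y \<and> a + y = b + x)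
      \<Longrightarrow> a = c \<and> b = d" for c d
    using that by (intro exI[of _ "(c, d)"]) (auto simp: mem_options_wythoff)
  consider "x = 0" "y = 0" | n where "x = 2 * n + 1" "y = 4 * n + 3" | "x = 0" "y = 1"
    | m where "x = 2 * m + 2" "y = 4 * m + 5" | "x = 2" "y = 2"
    | m d where "x = 2 * m + 2" "y = 2 * m + 2 * d + 2" "wpair m (m + d)" "d \<le> m" "0 < d"
    using P
  proof (cases rule: P2_cases)
    case 2
    show thesis
    proof (cases x rule: nat_parity_cases)
      case 1
      then show thesis
        using that(3) 2 by simp
    next
      case (2 n)
      then show thesis
        using that(2)[of n] \<open>y = 2 * x + 1\<close> by simp
    next
      case (3 m)
      then show thesis
        using that(4)[of m] 2 by simp
    qed
  next
    case (4 m n)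
    then obtain d where d: "n = m + d"
      using le le_Suc_ex by force
    show thesis
    proof (cases "d = 0")
      case True
      then have "partner m = m"
        using 4(3) d by (simp add: wpair_iff)
      then have "m = 0"
        using partner_diff_unique[of m 0 0] by simp
      then show thesis
        using that(5) 4(1,2) d True by simp
    next
      case False
      then show thesis
        using that(6)[of m d] 4 d by simp
    qed
  qed (use that(1) le in auto)
  then show ?thesis
  proof cases
    case 1
    show ?thesis
      \<comment> \<open>The origin has no options, so the candidate is a dummy.\<close>
      by (rule *[of 0 0]) (use 1 in auto)
  next
    case (2 n)
    show ?thesis
    proof (rule *[of x n])
      fix a b
      assume "(a, b) \<in> P2"
        and o: "(a < x \<and> b = y) \<or> (a = x \<and> b < y) \<or> (a < x \<and> b < y \<and> a + y = b + x)"
      then show "a = x \<and> b = n"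
      proof (cases rule: P2_cases)
        case 1
        then show ?thesis
          using 2 o by linarith
      next
        case 2
        then show ?thesis
          using \<open>x = 2 * n + 1\<close> \<open>y = 4 * n + 3\<close> o by linarith
      next
        case 3
        then show ?thesis
          using 2 o by linarith
      next
        case (4 m' n')
        have "even a" "even b" "odd x" "odd y"
          using 4(1,2) 2 by simp_all
        then have "a < x" "a + y = b + x"
          using o by auto
        \<comment> \<open>On the diagonal \<open>n' = m' + n + 1\<close>, so
          \<open>n' \<le> 2 * m'\<close> forces \<open>m' > n\<close>, whereas \<open>a < x\<close>
          forces \<open>m' < n\<close>.\<close>
        then show ?thesis
          using 4 2 by linarith
      qed
    qed
  next
    case 3
    show ?thesis
      by (rule *[of 0 0]) (use 3 in auto)
  next
    case (4 m)
    show ?thesis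
    proof (rule *[of x "2 * partner m + 2"])
      fix a b
      assume "(a, b) \<in> P2"
        and o: "(a < x \<and> b = y) \<or> (a = x \<and> b < y) \<or> (a < x \<and> b < y \<and> a + y = b + x)"
      then show "a = x \<and> b = 2 * partner m + 2"
      proof (cases rule: P2_cases)
        case (4 m' n')
        \<comment> \<open>Both \<open>y\<close> and \<open>y - x\<close> are odd, so an even point
          can only share the column.\<close>
        then have "m' = m \<and> a = x"
          using \<open>x = 2 * m + 2\<close> \<open>y = 4 * m + 5\<close> o
          by (elim disjE conjE) (simp_all; presburger)+
        then show ?thesis
          using 4 by (simp add: wpair_iff)
      qed (use 4 o in \<open>auto; presburger\<close>)+
    qed
  next
    case 5
    show ?thesis
    proof (rule *[of 0 0])
      fix a b
      assume "(a, b) \<in> P2"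
        and o: "(a < x \<and> b = y) \<or> (a = x \<and> b < y) \<or> (a < x \<and> b < y \<and> a + y = b + x)"
      then show "a = 0 \<and> b = 0"
        by (cases rule: P2_cases) (use 5 o in \<open>auto; presburger\<close>)+
    qed
  next
    case (6 m d)
    show ?thesis
    proof (rule *[of "2 * d - 1" "4 * d - 1"])
      fix a b
      assume "(a, b) \<in> P2"
        and o: "(a < x \<and> b = y) \<or> (a = x \<and> b < y) \<or> (a < x \<and> b < y \<and> a + y = b + x)"
      then show "a = 2 * d - 1 \<and> b = 4 * d - 1"
      proof (cases rule: P2_cases)
        case (4 m' n')
        \<comment> \<open>Diagonal, row and column in turn. Each forces the Wythoff pair
          \<open>(m, m + d)\<close> itself, which is the current position and not an option.\<close>
        have "n' = m' + d \<or> n' = m + d \<or> m' = m"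
          using 4(1,2) 6(1,2) o by (elim disjE conjE) simp_all
        moreover have "n' = m' + d \<Longrightarrow> m' = m"
          using partner_diff_unique[of m d m'] 4(3) 6(3) by (simp add: wpair_iff)
        moreover have "n' = m + d \<Longrightarrow> m' = m"
          using 4(3) 6(3) wpair_sym wpair_unique by blast
        ultimately have "m' = m"
          by blast
        then have "n' = m + d"
          using 4(3) 6(3) wpair_unique by blast
        then show ?thesis
          using \<open>m' = m\<close> 4(1,2) 6(1,2) o by (elim disjE conjE) simp_all
      qed (use 6 o in \<open>auto; presburger\<close>)+
    qed
  qed
qed

text \<open>Far above the line \<open>y = 2 * x + 1\<close> the column holds two P-options.
  Otherwise the diagonal supplies one; the other comes from the column if \<open>x\<close> is odd,
  from the row if only \<open>y\<close> is odd, and from Wythoff Nim on the halved position if both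
  are even.\<close>

lemma P2_options_two:
  assumes N: "(x, y) \<notin> P2" and le: "x \<le> y"
  shows "2 \<le> card (options wythoff_moves (x, y) \<inter> P2)"
proof -
  let ?A = "options wythoff_moves (x, y) \<inter> P2"
  have fin: "finite ?A"
    by (simp add: options_finite)
  have "\<exists>q\<in>?A. \<exists>q'\<in>?A. q \<noteq> q'"
  proof (cases "2 * x + 1 < y")
    case True
    then have col: "(x, 2 * x + 1) \<in> ?A"
      by (simp add: mem_options_wythoff P2_def)
    consider "x = 0" | n where "x = 2 * n + 1" | m where "x = 2 * m + 2"
      by (rule nat_parity_cases)
    then have "\<exists>b \<le> 2 * x. (x, b) \<in> P2"
    proof cases
      case 1
      then show ?thesis by (auto simp: P2_def)
    next
      case (2 n)
      then show ?thesis by (intro exI[of _ n]) (auto simp: P2_def)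
    next
      case (3 m)
      then show ?thesis
        using partner_le[of m] by (intro exI[of _ "2 * partner m + 2"]) (auto simp: P2_def)
    qed
    then obtain b where "b \<le> 2 * x" "(x, b) \<in> P2"
      by blast
    then have "(x, b) \<in> ?A" "(x, b) \<noteq> (x, 2 * x + 1)"
      using True by (auto simp: mem_options_wythoff)
    then show ?thesis
      using col by blast
  next
    case False
    then have y: "y \<le> 2 * x" "0 < x"
      using N le by (auto simp: P2_def)
    \<comment> \<open>The parity clauses later separate this point from the even points
      \<open>2 * c + 2\<close> of the same diagonal.\<close>
    obtain a where a: "a < x" "(a, a + (y - x)) \<in> ?A" "even (y - x) \<longrightarrow> x \<noteq> y \<longrightarrow> odd a" "x = y \<longrightarrow> a = 0"
    proof (cases "x = y")
      case True
      then show thesis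
        using that[of 0] y by (auto simp: mem_options_wythoff P2_def)
    next
      case False
      then obtain e where "y = x + e + 1"
        using le less_imp_Suc_add[of x y] by auto
      then show thesis
        using that[of e] y by (auto simp: mem_options_wythoff P2_def)
    qed
    have "\<exists>q\<in>?A. q \<noteq> (a, a + (y - x))"
    proof (cases x rule: nat_parity_cases)
      case (2 n)
      then show ?thesis
        using a(1) le by (intro bexI[of _ "(x, n)"]) (auto simp: mem_options_wythoff P2_def)
    next
      case m: (3 m)
      show ?thesis
      proof (cases y rule: nat_parity_cases)
        case (2 n)
        then show ?thesis
          using a(1) le y by (intro bexI[of _ "(n, y)"]) (auto simp: mem_options_wythoff P2_def)
      next
        case r: (3 r)
        have "m \<le> r" "partner m \<noteq> r"
          using N le m r by (auto simp: P2_def)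
        then consider "partner m < r" | c where "c < m" "partner c = c + (r - m)"
          using partner_absorbing by blast
        then show ?thesis
        proof cases
          case 1
          then show ?thesis
            using m r a(1)
            by (intro bexI[of _ "(x, 2 * partner m + 2)"]) (auto simp: mem_options_wythoff P2_def)
        next
          case (2 c)
          then have "(2 * c + 2, 2 * partner c + 2) \<in> ?A"
            using m r \<open>m \<le> r\<close> by (auto simp: mem_options_wythoff P2_def)
          moreover have "a \<noteq> 2 * c + 2"
            using a(3,4) m r by auto
          ultimately show ?thesis
            by (intro bexI[of _ "(2 * c + 2, 2 * partner c + 2)"]) auto
        qed
      qed (use y le in simp)
    qed (use y in simp)
    then show ?thesis
      using a(2) by blast
  qed
  then show ?thesis
    using card_ge_2I[OF fin] by blast
qed

lemma P2_count:
  assumes "x \<le> y"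
  shows "(x, y) \<in> P2 \<longleftrightarrow> card (options wythoff_moves (x, y) \<inter> P2) < 2"
proof
  assume "(x, y) \<in> P2"
  then obtain q where "options wythoff_moves (x, y) \<inter> P2 \<subseteq> {q}"
    using P2_options_subset assms by blast
  then have "card (options wythoff_moves (x, y) \<inter> P2) \<le> card {q}"
    by (intro card_mono) auto
  then show "card (options wythoff_moves (x, y) \<inter> P2) < 2"
    by simp
next
  assume "card (options wythoff_moves (x, y) \<inter> P2) < 2"
  then show "(x, y) \<in> P2"
    using P2_options_two[of x y] assms by fastforce
qed

lemma P_positions_2: "P_positions 2 wythoff_moves = P2"
  by (rule P_positions_eqI[OF zero_notin_wythoff_moves], simp, rule kernel_count_sym)
     (simp_all add: P2_count P2_sym)

text \<open>As \<open>l\<close> is a lower term, its partner is not below it, so row and column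
  contribute nothing; the diagonal has only the two fixed points.\<close>

lemma P2_options_diagonal:
  assumes "0 < l" "l \<le> partner l"
  shows "options wythoff_moves (2 * l + 2, 2 * l + 2) \<inter> P2 = {(0, 0), (2, 2)}"
proof
  show "{(0, 0), (2, 2)} \<subseteq> options wythoff_moves (2 * l + 2, 2 * l + 2) \<inter> P2"
    using assms by (auto simp: mem_options_wythoff P2_def intro!: exI[of _ 0])
next
  have "(a, b) \<in> {(0, 0), (2, 2)}"
    if "(a, b) \<in> options wythoff_moves (2 * l + 2, 2 * l + 2)" and P: "(a, b) \<in> P2" for a b
  proof -
    have o: "(a < 2 * l + 2 \<and> b = 2 * l + 2) \<or> (a = 2 * l + 2 \<and> b < 2 * l + 2) \<or> (a < 2 * l + 2 \<and> a = b)"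
      using that(1) by (auto simp: mem_options_wythoff)
    show ?thesis
      using P
    proof (cases rule: P2_cases)
      case 2
      then have False using o by presburger
      then show ?thesis ..
    next
      case 3
      then have False using o by presburger
      then show ?thesis ..
    next
      case (4 m n)
      then have "partner m = n" "partner n = m"
        using wpair_sym wpair_iff by blast+
      then have "\<not> (m < l \<and> n = l)" "\<not> (m = l \<and> n < l)"
        using assms by auto
      then have "m = n"
        using o 4 by auto
      then have "m = 0"
        using partner_diff_unique[of m 0 0] \<open>partner m = n\<close> by simp
      then show ?thesis
        using 4 \<open>m = n\<close> by simp
    qed simp
  qed
  then show "options wythoff_moves (2 * l + 2, 2 * l + 2) \<inter> P2 \<subseteq> {(0, 0), (2, 2)}"
    by (intro subrelI) blast
qed

lemma P2_options_odd:
  "options wythoff_moves (6 * j + 3, 10 * j + 6) \<inter> P2 = {(4 * j + 2, 8 * j + 5), (6 * j + 3, 3 * j + 1)}"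
proof
  show "{(4 * j + 2, 8 * j + 5), (6 * j + 3, 3 * j + 1)} \<subseteq> options wythoff_moves (6 * j + 3, 10 * j + 6) \<inter> P2"
    by (auto simp: mem_options_wythoff P2_def)
next
  have "(a, b) \<in> {(4 * j + 2, 8 * j + 5), (6 * j + 3, 3 * j + 1)}"
    if "(a, b) \<in> options wythoff_moves (6 * j + 3, 10 * j + 6)" and P: "(a, b) \<in> P2" for a b
  proof -
    have o: "(a < 6 * j + 3 \<and> b = 10 * j + 6) \<or> (a = 6 * j + 3 \<and> b < 10 * j + 6) \<or>
        (a < 6 * j + 3 \<and> b = a + 4 * j + 3)"
      using that(1) by (auto simp: mem_options_wythoff)
    show ?thesis
      using P
    proof (cases rule: P2_cases)
      case 1
      then show ?thesis using o by simp
    next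
      case 2
      then have "b \<noteq> 10 * j + 6"
        by presburger
      then have "a = 4 * j + 2" "b = 8 * j + 5"
        using 2 o by linarith+
      then show ?thesis by simp
    next
      case 3
      then have "a = 6 * j + 3" "b = 3 * j + 1"
        using o by linarith+
      then show ?thesis by simp
    next
      case (4 m n)
      then have "partner n = m"
        using wpair_sym wpair_iff by blast
      \<comment> \<open>In the row \<open>n = 5 * j + 2\<close>, so the ratio bound gives
        \<open>m \<ge> 3 * j + 1\<close>, which is already to the right of the position.\<close>
      then have "3 * n \<le> 5 * m + 1"
        using partner_ratio[of n] by simp
      moreover have "even a" "even b" "odd (6 * j + 3)" "odd (a + 4 * j + 3) \<longleftrightarrow> even a"
        using 4(1,2) by simp_all
      then have "a < 6 * j + 3" "b = 10 * j + 6"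
        using o by auto
      ultimately show ?thesis
        using 4(1,2) by linarith
    qed
  qed
  then show "options wythoff_moves (6 * j + 3, 10 * j + 6) \<inter> P2 \<subseteq> {(4 * j + 2, 8 * j + 5), (6 * j + 3, 3 * j + 1)}"
    by (intro subrelI) blast
qed

lemma not_redundant_2:
  assumes "m \<in> wythoff_moves"
  shows "\<not> redundant 2 wythoff_moves m"
proof -
  note I = not_redundantI[OF zero_notin_wythoff_moves, of 2, unfolded P_positions_2]
  obtain i where i: "1 \<le> i" "m = (i, 0) \<or> m = (0, i) \<or> m = (i, i)"
    using assms by (auto simp: wythoff_moves_def)
  consider "m = (i, 0)" | "m = (0, i)" | "m = (i, i)" "odd i" | "m = (i, i)" "even i"
    using i(2) by blast
  then show ?thesis
  proof cases
    case 1
    have "options wythoff_moves (1 + i, 0 + 0) \<inter> P2 = {(0, 0), (1, 0)}"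
      using i by (auto simp: mem_options_wythoff P2_def)
    then show ?thesis
      using I[of i 0 1 0] assms 1 by (simp add: P2_def)
  next
    case 2
    have "options wythoff_moves (0 + 0, 1 + i) \<inter> P2 = {(0, 0), (0, 1)}"
      using i by (auto simp: mem_options_wythoff P2_def)
    then show ?thesis
      using I[of 0 i 0 1] assms 2 by (simp add: P2_def)
  next
    case 3
    then obtain j where j: "i = 2 * j + 1"
      by (elim oddE)
    have "(4 * j + 2) + i = 6 * j + 3" "(8 * j + 5) + i = 10 * j + 6"
      using j by auto
    then have "options wythoff_moves ((4 * j + 2) + i, (8 * j + 5) + i) \<inter> P2
        = {(4 * j + 2, 8 * j + 5), (6 * j + 3, 3 * j + 1)}"
      using P2_options_odd by (simp only:)
    then show ?thesis
      using I[of i i "4 * j + 2" "8 * j + 5"] assms 3 by (simp add: P2_def)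
  next
    case 4
    then obtain h where h: "i = 2 * h + 2"
      using i(1) by (cases i rule: nat_parity_cases) auto
    show ?thesis
    proof (cases "0 < h \<and> h \<le> partner h")
      case True
      then have "options wythoff_moves (0 + i, 0 + i) \<inter> P2 = {(0, 0), (2, 2)}"
        using P2_options_diagonal[of h] h by simp
      then show ?thesis
        using I[of i i 0 0] assms 4 by (simp add: P2_def)
    next
      case False
      \<comment> \<open>For \<open>h = 0\<close> the position \<open>(2, 2)\<close> is itself P, so
        \<open>(4, 4)\<close> serves; for \<open>h\<close> an upper term, \<open>h + 1\<close> is a
        lower one.\<close>
      have "h + 1 \<le> partner (h + 1)"
      proof (cases "h = 0")
        case True
        have "partner 1 \<noteq> 0"
          by (metis partner_0 partner_partner zero_neq_one)
        then show ?thesis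
          using True by simp
      qed (use False partner_Suc_ge in auto)
      then have "options wythoff_moves (2 + i, 2 + i) \<inter> P2 = {(0, 0), (2, 2)}"
        using P2_options_diagonal[of "h + 1"] h by simp
      moreover have "(2, 2) \<in> P2"
        by (auto simp: P2_def intro!: exI[of _ 0])
      ultimately show ?thesis
        using I[of i i 2 2] assms 4 by simp
    qed
  qed
qed

theorem theorem31:
  shows "(\<forall>m \<in> wythoff_moves. \<not> redundant 2 wythoff_moves m) \<and>
         (\<forall>m \<in> wythoff_moves. \<not> redundant 3 wythoff_moves m)"
  using not_redundant_2 not_redundant_3 by blast

end
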